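(* Let $A$ be an $n\times n$ matrix with entries in the quaternions $\mathbb{H}$ and let $W=W(A)=\{\boldsymbol{x}^*A\boldsymbol{x}:\boldsymbol{x}\in\mathbb{H}^n,\ |\boldsymbol{x}|=1\}$ be its quaternionic numerical range. Then $$\mathcal{C}(W)=\big[\mathcal{C}(W\cap\mathbb{C})\big],$$ where $\mathcal{C}(\cdot)$ denotes the star-center of a set and $[X]=\bigcup_{x\in X}[x]$ denotes the union of the similarity classes of the elements of $X$.
   Context: $\mathbb{H}$ is the real algebra of Hamilton quaternions with basis $1,i,j,k$, and $\mathbb{C}=\mathrm{span}_{\mathbb{R}}\{1,i\}\subset\mathbb{H}$. $\boldsymbol{x}^*$ is the conjugate transpose of $\boldsymbol{x}\in\mathbb{H}^n$ and $|\boldsymbol{x}|^2=\boldsymbol{x}^*\boldsymbol{x}$. Two quaternions $q,q'$ are similar if there is a quaternion $s$ with $|s|=1$ and $s^*q's=q$; $[q]$ denotes the similarity class of $q$. For a subset $B$ of a real vector space, the star-center is $\mathcal{C}(B)=\{b_0\in B:(1-\alpha)b_0+\alpha b\in B\text{ for all } b\in B,\ \alpha\in[0,1]\}$ (possibly empty). *)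

theory Defs
  imports "HOL-Analysis.Analysis"
begin

text \<open>
  The Hamilton quaternions: \<open>Quat a b c d\<close> is \<open>a + b i + c j + d k\<close>.
\<close>

datatype quat = Quat (qRe: real) (qI: real) (qJ: real) (qK: real)

lemma quat_eq_iff: "p = q \<longleftrightarrow> qRe p = qRe q \<and> qI p = qI q \<and> qJ p = qJ q \<and> qK p = qK q"
  by (cases p; cases q) simp

instantiation quat :: ring_1
begin

definition "0 = Quat 0 0 0 0"
definition "1 = Quat 1 0 0 0"
definition "p + q = Quat (qRe p + qRe q) (qI p + qI q) (qJ p + qJ q) (qK p + qK q)"
definition "- p = Quat (- qRe p) (- qI p) (- qJ p) (- qK p)"
definition "p - q = Quat (qRe p - qRe q) (qI p - qI q) (qJ p - qJ q) (qK p - qK q)"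

definition "p * q = Quat
  (qRe p * qRe q - qI p * qI q - qJ p * qJ q - qK p * qK q)
  (qRe p * qI q + qI p * qRe q + qJ p * qK q - qK p * qJ q)
  (qRe p * qJ q - qI p * qK q + qJ p * qRe q + qK p * qI q)
  (qRe p * qK q + qI p * qJ q - qJ p * qI q + qK p * qRe q)"

instance
  by standard
    (simp_all add: quat_eq_iff zero_quat_def one_quat_def plus_quat_def uminus_quat_def
      minus_quat_def times_quat_def algebra_simps)

end

instantiation quat :: real_algebra_1
begin

definition "r *\<^sub>R q = Quat (r * qRe q) (r * qI q) (r * qJ q) (r * qK q)"

instance
  by standard
    (simp_all add: quat_eq_iff plus_quat_def one_quat_def times_quat_def scaleR_quat_def
      algebra_simps)

end

lemma quat_sel [simp]:
  "qRe 0 = 0" "qI 0 = 0" "qJ 0 = 0" "qK 0 = 0"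
  "qRe 1 = 1" "qI 1 = 0" "qJ 1 = 0" "qK 1 = 0"
  "qRe (p + q) = qRe p + qRe q" "qI (p + q) = qI p + qI q"
  "qJ (p + q) = qJ p + qJ q" "qK (p + q) = qK p + qK q"
  "qRe (p - q) = qRe p - qRe q" "qI (p - q) = qI p - qI q"
  "qJ (p - q) = qJ p - qJ q" "qK (p - q) = qK p - qK q"
  "qRe (- p) = - qRe p" "qI (- p) = - qI p" "qJ (- p) = - qJ p" "qK (- p) = - qK p"
  "qRe (r *\<^sub>R p) = r * qRe p" "qI (r *\<^sub>R p) = r * qI p"
  "qJ (r *\<^sub>R p) = r * qJ p" "qK (r *\<^sub>R p) = r * qK p"
  "qRe (p * q) = qRe p * qRe q - qI p * qI q - qJ p * qJ q - qK p * qK q"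
  "qI (p * q) = qRe p * qI q + qI p * qRe q + qJ p * qK q - qK p * qJ q"
  "qJ (p * q) = qRe p * qJ q - qI p * qK q + qJ p * qRe q + qK p * qI q"
  "qK (p * q) = qRe p * qK q + qI p * qJ q - qJ p * qI q + qK p * qRe q"
  by (simp_all add: zero_quat_def one_quat_def plus_quat_def uminus_quat_def
      minus_quat_def times_quat_def scaleR_quat_def)

definition qcnj :: "quat \<Rightarrow> quat" where
  "qcnj q = Quat (qRe q) (- qI q) (- qJ q) (- qK q)"

lemma qcnj_sel [simp]:
  "qRe (qcnj q) = qRe q" "qI (qcnj q) = - qI q" "qJ (qcnj q) = - qJ q" "qK (qcnj q) = - qK q"
  by (simp_all add: qcnj_def)

instantiation quat :: real_inner
begin

definition "p \<bullet> q = qRe p * qRe q + qI p * qI q + qJ p * qJ q + qK p * qK q"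
definition "norm q = sqrt ((qRe q)\<^sup>2 + (qI q)\<^sup>2 + (qJ q)\<^sup>2 + (qK q)\<^sup>2)"
definition "dist p q = norm (p - q)" for p q :: quat
definition "sgn q = q /\<^sub>R norm q" for q :: quat
definition "uniformity = (INF e\<in>{0<..}. principal {(p :: quat, q). dist p q < e})"
definition "open U \<longleftrightarrow> (\<forall>q\<in>U. eventually (\<lambda>(p', p). p' = q \<longrightarrow> p \<in> U) uniformity)"
  for U :: "quat set"

instance
proof
  fix p :: quat
  have "p \<bullet> p = (qRe p)\<^sup>2 + (qI p)\<^sup>2 + (qJ p)\<^sup>2 + (qK p)\<^sup>2"
    by (simp add: inner_quat_def power2_eq_square)
  then show "0 \<le> p \<bullet> p" "norm p = sqrt (p \<bullet> p)" "p \<bullet> p = 0 \<longleftrightarrow> p = 0"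
    by (simp_all add: norm_quat_def quat_eq_iff add_nonneg_eq_0_iff)
qed (simp_all add: dist_quat_def sgn_quat_def uniformity_quat_def open_quat_def
    inner_quat_def algebra_simps)

end

instantiation quat :: real_normed_div_algebra
begin

definition "inverse q = qcnj q /\<^sub>R (norm q)\<^sup>2"
definition "p div q = p * inverse q" for p q :: quat

instance
proof
  fix p q :: quat
  show "norm (p * q) = norm p * norm q"
    unfolding norm_quat_def real_sqrt_mult [symmetric]
    by (rule arg_cong [where f = sqrt]) (simp add: power2_eq_square algebra_simps)
  show "inverse (0 :: quat) = 0"
    by (simp add: inverse_quat_def quat_eq_iff)
  assume "p \<noteq> 0"
  then have "(norm p)\<^sup>2 \<noteq> 0"
    by simp
  moreover have "(norm p)\<^sup>2 = qRe p * qRe p + qI p * qI p + qJ p * qJ p + qK p * qK p"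
    by (simp add: norm_quat_def power2_eq_square)
  moreover have "qcnj p * p = (norm p)\<^sup>2 *\<^sub>R 1" "p * qcnj p = (norm p)\<^sup>2 *\<^sub>R 1"
    using calculation(2) by (simp_all add: quat_eq_iff)
  ultimately show "inverse p * p = 1" "p * inverse p = 1"
    by (simp_all add: inverse_quat_def)
qed (simp add: divide_quat_def)

end

instantiation quat :: euclidean_space
begin

definition "Basis = {Quat 1 0 0 0, Quat 0 1 0 0, Quat 0 0 1 0, Quat 0 0 0 1}"

instance
proof
  fix u v p :: quat
  show "(Basis :: quat set) \<noteq> {}" "finite (Basis :: quat set)"
    by (simp_all add: Basis_quat_def)
  show "u \<in> Basis \<Longrightarrow> v \<in> Basis \<Longrightarrow> u \<bullet> v = (if u = v then 1 else 0)"
    unfolding Basis_quat_def by (elim insertE emptyE) (simp_all add: inner_quat_def)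
  show "(\<forall>u\<in>Basis. p \<bullet> u = 0) \<longleftrightarrow> p = 0"
    by (simp add: Basis_quat_def inner_quat_def quat_eq_iff [of p])
qed

end

definition quat_complex :: "quat set" where
  "quat_complex = span {1, Quat 0 1 0 0}"

definition quat_similar :: "quat \<Rightarrow> quat \<Rightarrow> bool" where
  "quat_similar q q' \<longleftrightarrow> (\<exists>s. norm s = 1 \<and> qcnj s * q' * s = q)"

definition similarity_class :: "quat \<Rightarrow> quat set" where
  "similarity_class q = {q'. quat_similar q q'}"

definition similarity_hull :: "quat set \<Rightarrow> quat set" where
  "similarity_hull X = (\<Union>x\<in>X. similarity_class x)"

text \<open>\<open>hprod x y\<close> is \<open>x\<^sup>* y\<close>.\<close>

definition hprod :: "quat ^ 'n \<Rightarrow> quat ^ 'n \<Rightarrow> quat" where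
  "hprod x y = (\<Sum>i\<in>UNIV. qcnj (x $ i) * y $ i)"

text \<open>The library norm on \<open>quat ^ 'n\<close> is the one given by \<open>|x|\<^sup>2 = x\<^sup>* x\<close>.\<close>

lemma hprod_self: "hprod x x = of_real ((norm x)\<^sup>2)"
proof -
  have "qcnj q * q = of_real ((norm q)\<^sup>2)" for q
    by (simp add: quat_eq_iff of_real_def norm_quat_def power2_eq_square)
  then show ?thesis
    by (simp add: hprod_def norm_vec_def L2_set_def sum_nonneg)
qed

definition numerical_range :: "quat ^ 'n ^ 'n \<Rightarrow> quat set" where
  "numerical_range A = {hprod x (A *v x) | x. norm x = 1}"

definition star_center :: "'a::real_vector set \<Rightarrow> 'a set" where
  "star_center B = {b\<^sub>0 \<in> B. \<forall>b\<in>B. \<forall>\<alpha>\<in>{0..1}. (1 - \<alpha>) *\<^sub>R b\<^sub>0 + \<alpha> *\<^sub>R b \<in> B}"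

end

theory Submission
  imports Defs
begin

text \<open>
  The statement is a geometric fact about every set \<open>W\<close> of quaternions that is a union of
  similarity classes; multiplying unit vectors by unit quaternions on the right shows that a
  numerical range is such a set (\<open>numerical_range_similar\<close>). Two quaternions are similar iff their
  real parts and the lengths of their imaginary parts agree (\<open>quat_similar_iff\<close>), so \<open>W\<close> arises
  from its planar section \<open>W \<inter> \<complex>\<close> by rotating imaginary parts, and the section is symmetric under
  complex conjugation.

  A point of the star-center of \<open>W\<close> can be rotated into \<open>\<complex>\<close>, and its rotated copy is still in the
  star-center of \<open>W\<close>, hence of \<open>W \<inter> \<complex>\<close>. The other inclusion needs an argument, because the segment
  from \<open>z \<in> \<complex>\<close> to a point \<open>w \<in> W\<close> outside the plane becomes a curve when it is rotated into the plane
  point by point. The star-center of any set is convex (\<open>convex_star_center\<close>), so if \<open>z\<close> is in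
  the star-center of \<open>W \<inter> \<complex>\<close>, then with \<open>z\<close> and its conjugate the whole vertical segment between
  them is in that star-center. By the reverse triangle inequality for imaginary parts, each
  point of the curve lies on a straight segment from some point of that vertical segment to the
  rotated copy of \<open>w\<close> in the upper half plane, and is therefore in \<open>W\<close>.
\<close>

section \<open>Star-centers\<close>

lemma star_centerD:
  assumes "p \<in> star_center B" and "b \<in> B" and "0 \<le> \<alpha>" and "\<alpha> \<le> 1"
  shows "(1 - \<alpha>) *\<^sub>R p + \<alpha> *\<^sub>R b \<in> B"
  using assms by (auto simp: star_center_def)

text \<open>
  A point on the segment from \<open>u p + v q\<close> to \<open>b\<close> is a convex combination of \<open>p\<close>, \<open>q\<close> and \<open>b\<close>. It is
  reached by first moving from \<open>q\<close> towards \<open>b\<close> and then from \<open>p\<close> towards the point thus obtained,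
  without leaving \<open>B\<close>.
\<close>

lemma convex_star_center: "convex (star_center B)"
proof (rule convexI)
  fix p q and u v :: real
  assume p: "p \<in> star_center B" and q: "q \<in> star_center B"
    and u: "0 \<le> u" and v: "0 \<le> v" and uv: "u + v = 1"
  have u_eq: "u = 1 - v"
    using uv by simp
  have comb: "(1 - \<alpha>) *\<^sub>R (u *\<^sub>R p + v *\<^sub>R q) + \<alpha> *\<^sub>R b \<in> B"
    if b: "b \<in> B" and \<alpha>: "0 \<le> \<alpha>" "\<alpha> \<le> 1" for b \<alpha>
  proof -
    define \<beta> where "\<beta> = (1 - \<alpha>) * v + \<alpha>"
    have \<beta>1: "1 - \<beta> = (1 - \<alpha>) * u"
      unfolding \<beta>_def u_eq by (simp add: algebra_simps)
    have "0 \<le> (1 - \<alpha>) * u" "0 \<le> (1 - \<alpha>) * v"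
      using \<alpha> u v by simp_all
    then have \<beta>0: "0 \<le> \<beta>" and \<beta>le: "\<beta> \<le> 1" and \<alpha>\<beta>: "\<alpha> \<le> \<beta>"
      using \<beta>1 \<beta>_def \<alpha> by linarith+
    \<comment> \<open>When \<open>\<beta> = 0\<close>, also \<open>\<alpha> = 0\<close>, and the convention \<open>\<alpha> / 0 = 0\<close> gives the right equations below.\<close>
    have \<gamma>: "\<beta> * (\<alpha> / \<beta>) = \<alpha>" "0 \<le> \<alpha> / \<beta>" "\<alpha> / \<beta> \<le> 1"
      using \<alpha> \<alpha>\<beta> \<beta>0 by (auto simp: divide_le_eq_1)
    have coeff: "\<beta> * (1 - \<alpha> / \<beta>) = (1 - \<alpha>) * v"
      using \<gamma>(1) by (simp add: \<beta>_def right_diff_distrib)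
    have "(1 - \<alpha> / \<beta>) *\<^sub>R q + (\<alpha> / \<beta>) *\<^sub>R b \<in> B"
      using q b \<gamma> by (intro star_centerD) auto
    then have "(1 - \<beta>) *\<^sub>R p + \<beta> *\<^sub>R ((1 - \<alpha> / \<beta>) *\<^sub>R q + (\<alpha> / \<beta>) *\<^sub>R b) \<in> B"
      using \<beta>0 \<beta>le by (rule star_centerD [OF p])
    also have "(1 - \<beta>) *\<^sub>R p + \<beta> *\<^sub>R ((1 - \<alpha> / \<beta>) *\<^sub>R q + (\<alpha> / \<beta>) *\<^sub>R b)
        = (1 - \<alpha>) *\<^sub>R (u *\<^sub>R p + v *\<^sub>R q) + \<alpha> *\<^sub>R b"
      by (simp only: scaleR_add_right scaleR_scaleR \<beta>1 coeff \<gamma>(1) add.assoc)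
    finally show ?thesis .
  qed
  have "q \<in> B"
    using q by (simp add: star_center_def)
  then have "(1 - v) *\<^sub>R p + v *\<^sub>R q \<in> B"
    using p u v uv by (intro star_centerD) auto
  moreover have "1 - v = u"
    using uv by simp
  ultimately show "u *\<^sub>R p + v *\<^sub>R q \<in> star_center B"
    using comb by (simp add: star_center_def)
qed

lemma star_center_linear_symmetry:
  assumes "linear f" and "\<And>b. b \<in> B \<Longrightarrow> f b \<in> B" and "\<And>b. b \<in> B \<Longrightarrow> g b \<in> B"
    and fg: "\<And>b. f (g b) = b" and p: "p \<in> star_center B"
  shows "f p \<in> star_center B"
proof -
  have "(1 - \<alpha>) *\<^sub>R f p + \<alpha> *\<^sub>R b \<in> B" if "b \<in> B" "0 \<le> \<alpha>" "\<alpha> \<le> 1" for b \<alpha>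
  proof -
    have "(1 - \<alpha>) *\<^sub>R f p + \<alpha> *\<^sub>R b = f ((1 - \<alpha>) *\<^sub>R p + \<alpha> *\<^sub>R g b)"
      using \<open>linear f\<close> fg by (simp add: linear_add linear_scale)
    then show ?thesis
      using assms that star_centerD [OF p] by simp
  qed
  then show ?thesis
    using p assms(2) by (auto simp: star_center_def)
qed

section \<open>Similarity of quaternions\<close>

lemma quat_complex_iff: "q \<in> quat_complex \<longleftrightarrow> qJ q = 0 \<and> qK q = 0"
proof -
  have "(\<exists>a b. q - a *\<^sub>R 1 = b *\<^sub>R Quat 0 1 0 0) \<longleftrightarrow> qJ q = 0 \<and> qK q = 0"
    by (auto simp: quat_eq_iff)
  then show ?thesis
    by (simp add: quat_complex_def span_insert)
qed

lemma qcnj_mult: "qcnj (p * q) = qcnj q * qcnj p"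
  by (simp add: quat_eq_iff algebra_simps)

lemma norm_qcnj [simp]: "norm (qcnj q) = norm q"
  by (simp add: norm_quat_def)

lemma qcnj_qcnj [simp]: "qcnj (qcnj q) = q"
  by (simp add: quat_eq_iff)

lemma qcnj_unit:
  assumes "norm s = 1"
  shows "qcnj s * s = 1" and "s * qcnj s = 1"
proof -
  have "qRe s * qRe s + qI s * qI s + qJ s * qJ s + qK s * qK s = 1"
    using assms by (simp add: norm_quat_def power2_eq_square)
  then show "qcnj s * s = 1" "s * qcnj s = 1"
    by (simp_all add: quat_eq_iff)
qed

lemma quat_similarI: "norm s = 1 \<Longrightarrow> q' * s = s * q \<Longrightarrow> quat_similar q q'"
  using qcnj_unit [of s] by (metis quat_similar_def mult.assoc mult_1)

lemma quat_similar_sym: "quat_similar q q' \<Longrightarrow> quat_similar q' q"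
proof -
  assume "quat_similar q q'"
  then obtain s where s: "norm s = 1" and q: "qcnj s * q' * s = q"
    by (auto simp: quat_similar_def)
  have "q * qcnj s = qcnj s * q' * (s * qcnj s)"
    by (simp only: q [symmetric] mult.assoc)
  also have "\<dots> = qcnj s * q'"
    by (simp add: qcnj_unit [OF s])
  finally show ?thesis
    using s by (intro quat_similarI [of "qcnj s"]) auto
qed

lemma quat_similar_trans:
  assumes "quat_similar p q" and "quat_similar q r"
  shows "quat_similar p r"
proof -
  obtain s t where "norm s = 1" "qcnj s * q * s = p" "norm t = 1" "qcnj t * r * t = q"
    using assms by (auto simp: quat_similar_def)
  then have "norm (t * s) = 1" "qcnj (t * s) * r * (t * s) = p"
    by (auto simp: norm_mult qcnj_mult mult.assoc)
  then show ?thesis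
    by (auto simp: quat_similar_def)
qed

definition quat_im :: "quat \<Rightarrow> quat" where
  "quat_im q = Quat 0 (qI q) (qJ q) (qK q)"

lemma quat_im_linear: "quat_im (p + q) = quat_im p + quat_im q" "quat_im (c *\<^sub>R q) = c *\<^sub>R quat_im q"
  by (simp_all add: quat_im_def quat_eq_iff)

lemma norm_quat_im_complex [simp]: "norm (quat_im (Quat a b 0 0)) = \<bar>b\<bar>"
  by (simp add: quat_im_def norm_quat_def)

text \<open>The representative of the similarity class of \<open>q\<close> in the closed upper half plane.\<close>

definition quat_upper :: "quat \<Rightarrow> quat" where
  "quat_upper q = Quat (qRe q) (norm (quat_im q)) 0 0"

lemma quat_upper_complex: "quat_upper q \<in> quat_complex"
  by (simp add: quat_complex_iff quat_upper_def)

text \<open>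
  If \<open>u\<close> and \<open>v\<close> are purely imaginary of the same length, then \<open>u\<^sup>2 = v\<^sup>2\<close>, so \<open>u (u + v) = (u + v) v\<close>
  and \<open>u + v\<close>, once normalised, conjugates \<open>u\<close> to \<open>v\<close>. This is applied to \<open>u = r i\<close> and
  \<open>v = Im q\<close>, and it breaks down only for \<open>v = - r i\<close>, where \<open>j\<close> does the job.
\<close>

lemma quat_similar_upper: "quat_similar q (quat_upper q)"
proof -
  define r where "r = norm (quat_im q)"
  define t where "t = Quat 0 (r + qI q) (qJ q) (qK q)"
  have "r * r = (norm (quat_im q))\<^sup>2"
    by (simp add: r_def power2_eq_square)
  then have rr: "r * r = qI q * qI q + qJ q * qJ q + qK q * qK q"
    by (simp add: norm_quat_def quat_im_def power2_eq_square)
  have up: "quat_upper q = Quat (qRe q) r 0 0"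
    by (simp add: quat_upper_def r_def)
  have comm: "quat_upper q * t = t * q"
    using rr by (simp add: quat_eq_iff up t_def algebra_simps)
  show ?thesis
  proof (cases "t = 0")
    case True
    then have "qI q = - r" "qJ q = 0" "qK q = 0"
      by (auto simp: t_def quat_eq_iff)
    then have "quat_upper q * Quat 0 0 1 0 = Quat 0 0 1 0 * q"
      by (simp add: quat_eq_iff up)
    moreover have "norm (Quat 0 0 1 0) = 1"
      by (simp add: norm_quat_def)
    ultimately show ?thesis
      by (intro quat_similarI)
  next
    case False
    have "quat_upper q * (t /\<^sub>R norm t) = (t /\<^sub>R norm t) * q"
      using comm by simp
    moreover have "norm (t /\<^sub>R norm t) = 1"
      using False by simp
    ultimately show ?thesis
      by (intro quat_similarI)
  qed
qed

text \<open>
  The map \<open>q \<mapsto> s\<^sup>* q s\<close> for a unit \<open>s\<close> preserves the norm and the real part, and the two determine the length of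
  the imaginary part. Conversely, equal data mean equal representatives in the upper half plane.
\<close>

lemma quat_similar_iff:
  "quat_similar p q \<longleftrightarrow> qRe p = qRe q \<and> norm (quat_im p) = norm (quat_im q)"
proof
  assume "quat_similar p q"
  then obtain s where s: "norm s = 1" and p: "p = qcnj s * q * s"
    by (auto simp: quat_similar_def)
  have s2: "qRe s * qRe s + qI s * qI s + qJ s * qJ s + qK s * qK s = 1"
    using s by (simp add: norm_quat_def power2_eq_square)
  have "qRe p = qRe q * (qRe s * qRe s + qI s * qI s + qJ s * qJ s + qK s * qK s)"
    by (simp add: p algebra_simps)
  with s2 have re: "qRe p = qRe q"
    by simp
  have im: "(norm (quat_im x))\<^sup>2 = (norm x)\<^sup>2 - (qRe x)\<^sup>2" for x
    by (simp add: norm_quat_def quat_im_def)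
  have "norm p = norm q"
    by (simp add: p norm_mult s)
  with re have "(norm (quat_im p))\<^sup>2 = (norm (quat_im q))\<^sup>2"
    by (simp add: im)
  with re show "qRe p = qRe q \<and> norm (quat_im p) = norm (quat_im q)"
    by simp
next
  assume "qRe p = qRe q \<and> norm (quat_im p) = norm (quat_im q)"
  then have "quat_upper p = quat_upper q"
    by (simp add: quat_upper_def)
  then show "quat_similar p q"
    by (metis quat_similar_upper quat_similar_sym quat_similar_trans)
qed

section \<open>Star-centers of similarity-invariant sets\<close>

lemma similarity_invariantD:
  "similarity_hull W \<subseteq> W \<Longrightarrow> q \<in> W \<Longrightarrow> quat_similar p q \<Longrightarrow> p \<in> W"
  by (auto simp: similarity_hull_def similarity_class_def dest: quat_similar_sym)

lemma star_center_similar: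
  assumes inv: "similarity_hull W \<subseteq> W"
    and z: "z \<in> star_center W" and "quat_similar b z"
  shows "b \<in> star_center W"
proof -
  obtain s where s: "norm s = 1" and b: "qcnj s * z * s = b"
    using \<open>quat_similar b z\<close> by (auto simp: quat_similar_def)
  have "(\<lambda>q. qcnj s * q * s) z \<in> star_center W"
  proof (rule star_center_linear_symmetry [where f = "\<lambda>q. qcnj s * q * s"
        and g = "\<lambda>q. s * q * qcnj s"])
    show "linear (\<lambda>q. qcnj s * q * s)"
      by (rule linearI) (simp_all add: distrib_left distrib_right)
    show "qcnj s * q * s \<in> W" if "q \<in> W" for q
      using s by (intro similarity_invariantD [OF inv that]) (auto simp: quat_similar_def)
    show "s * q * qcnj s \<in> W" if "q \<in> W" for q
    proof (rule similarity_invariantD [OF inv that])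
      show "quat_similar (s * q * qcnj s) q"
        unfolding quat_similar_def using s by (intro exI [of _ "qcnj s"]) simp
    qed
    show "qcnj s * (s * q * qcnj s) * s = q" for q
    proof -
      have "qcnj s * (s * q * qcnj s) * s = (qcnj s * s) * q * (qcnj s * s)"
        by (simp only: mult.assoc)
      then show ?thesis
        by (simp add: qcnj_unit [OF s])
    qed
  qed (rule z)
  then show ?thesis
    by (simp add: b)
qed

text \<open>
  Conjugation maps the planar section to itself, so it maps the star-center of the section to
  itself; by convexity that star-center contains the segment joining a point to its conjugate.
\<close>

lemma star_center_vertical_segment:
  assumes inv: "similarity_hull W \<subseteq> W"
    and z: "Quat t s 0 0 \<in> star_center (W \<inter> quat_complex)" and \<mu>: "\<bar>\<mu>\<bar> \<le> \<bar>s\<bar>"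
  shows "Quat t \<mu> 0 0 \<in> star_center (W \<inter> quat_complex)"
proof -
  have "qcnj (Quat t s 0 0) \<in> star_center (W \<inter> quat_complex)"
  proof (rule star_center_linear_symmetry [where f = qcnj and g = qcnj])
    show "linear qcnj"
      by (rule linearI) (simp_all add: quat_eq_iff)
    show "qcnj q \<in> W \<inter> quat_complex" if "q \<in> W \<inter> quat_complex" for q
    proof -
      have "quat_similar (qcnj q) q"
        by (simp add: quat_similar_iff norm_quat_def quat_im_def)
      then show ?thesis
        using that similarity_invariantD [OF inv] by (auto simp: quat_complex_iff)
    qed
    then show "qcnj q \<in> W \<inter> quat_complex" if "q \<in> W \<inter> quat_complex" for q
      using that .
  qed (simp_all add: z)
  then have zc: "Quat t (- s) 0 0 \<in> star_center (W \<inter> quat_complex)"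
    by (simp add: qcnj_def)
  show ?thesis
  proof (cases "s = 0")
    case True
    then show ?thesis
      using z \<mu> by simp
  next
    case False
    have "\<bar>\<mu> / s\<bar> \<le> 1"
      using \<mu> False by simp
    then have bounds: "0 \<le> (1 + \<mu> / s) / 2" "0 \<le> (1 - \<mu> / s) / 2"
      by (simp_all add: abs_le_iff del: abs_divide)
    have "((1 + \<mu> / s) / 2) *\<^sub>R Quat t s 0 0 + ((1 - \<mu> / s) / 2) *\<^sub>R Quat t (- s) 0 0
        \<in> star_center (W \<inter> quat_complex)"
      using z zc bounds by (intro convexD [OF convex_star_center]) (auto simp: field_simps)
    also have "((1 + \<mu> / s) / 2) *\<^sub>R Quat t s 0 0 + ((1 - \<mu> / s) / 2) *\<^sub>R Quat t (- s) 0 0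
        = Quat t \<mu> 0 0"
      using False by (simp add: quat_eq_iff field_simps)
    finally show ?thesis .
  qed
qed

text \<open>
  For a point \<open>p\<close> short of \<open>w\<close> on the segment from \<open>z\<close> to \<open>w\<close>, the representative of \<open>p\<close> in the
  upper half plane divides, in the same ratio, the segment from a point \<open>Re z + \<mu> i\<close> to the
  representative of \<open>w\<close>.
  The reverse triangle inequality gives \<open>|\<mu>| \<le> |Im z|\<close>, so \<open>Re z + \<mu> i\<close> is in the star-center
  of the section. Hence the representative of \<open>p\<close> is in \<open>W\<close>, and so is \<open>p\<close>.
\<close>

lemma star_center_complex_section:
  assumes inv: "similarity_hull W \<subseteq> W"
    and z: "z \<in> star_center (W \<inter> quat_complex)"
  shows "z \<in> star_center W"
proof -
  have zW: "z \<in> W" and "z \<in> quat_complex"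
    using z by (auto simp: star_center_def)
  then have z_eq: "z = Quat (qRe z) (qI z) 0 0"
    by (simp add: quat_eq_iff quat_complex_iff)
  have "(1 - \<alpha>) *\<^sub>R z + \<alpha> *\<^sub>R w \<in> W" if w: "w \<in> W" and \<alpha>: "0 \<le> \<alpha>" "\<alpha> \<le> 1" for w \<alpha>
  proof (cases "\<alpha> = 1")
    case True
    then show ?thesis
      using w by simp
  next
    case False
    define p where "p = (1 - \<alpha>) *\<^sub>R z + \<alpha> *\<^sub>R w"
    \<comment> \<open>The height \<open>\<mu>\<close> solves \<open>(1 - \<alpha>) \<mu> + \<alpha> |Im w| = |Im p|\<close>.\<close>
    define \<mu> where "\<mu> = (norm (quat_im p) - \<alpha> * norm (quat_im w)) / (1 - \<alpha>)"
    have \<mu>_eq: "(1 - \<alpha>) * \<mu> = norm (quat_im p) - \<alpha> * norm (quat_im w)"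
      using False by (simp add: \<mu>_def)
    have "(1 - \<alpha>) * \<bar>\<mu>\<bar> = \<bar>(1 - \<alpha>) * \<mu>\<bar>"
      using \<alpha> by (simp add: abs_mult)
    also have "\<dots> = \<bar>norm (quat_im p) - norm (\<alpha> *\<^sub>R quat_im w)\<bar>"
      using \<alpha> by (simp add: \<mu>_eq)
    also have "\<dots> \<le> norm (quat_im p - \<alpha> *\<^sub>R quat_im w)"
      by (rule norm_triangle_ineq3)
    also have "\<dots> = norm ((1 - \<alpha>) *\<^sub>R quat_im z)"
      by (simp add: p_def quat_im_linear)
    also have "\<dots> = (1 - \<alpha>) * \<bar>qI z\<bar>"
      using \<alpha> by (subst z_eq) simp
    finally have "\<bar>\<mu>\<bar> \<le> \<bar>qI z\<bar>"
      using \<alpha> False by simp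
    then have m: "Quat (qRe z) \<mu> 0 0 \<in> star_center (W \<inter> quat_complex)"
      using star_center_vertical_segment [OF inv] z z_eq by metis
    have "quat_upper w \<in> W \<inter> quat_complex"
      using similarity_invariantD [OF inv w quat_similar_sym [OF quat_similar_upper]]
      by (simp add: quat_upper_complex)
    then have "(1 - \<alpha>) *\<^sub>R Quat (qRe z) \<mu> 0 0 + \<alpha> *\<^sub>R quat_upper w \<in> W \<inter> quat_complex"
      using \<alpha> by (rule star_centerD [OF m])
    also have "(1 - \<alpha>) *\<^sub>R Quat (qRe z) \<mu> 0 0 + \<alpha> *\<^sub>R quat_upper w = quat_upper p"
      using \<mu>_eq by (simp add: quat_eq_iff quat_upper_def p_def)
    finally show ?thesis
      using similarity_invariantD [OF inv _ quat_similar_upper [of p]] by (simp add: p_def)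
  qed
  then show ?thesis
    using zW by (simp add: star_center_def)
qed

lemma star_center_similarity_invariant:
  assumes inv: "similarity_hull W \<subseteq> W"
  shows "star_center W = similarity_hull (star_center (W \<inter> quat_complex))"
proof (intro set_eqI iffI)
  fix b
  assume b: "b \<in> star_center W"
  have sim: "quat_similar (quat_upper b) b"
    by (rule quat_similar_sym [OF quat_similar_upper])
  then have up: "quat_upper b \<in> star_center W"
    by (rule star_center_similar [OF inv b])
  have "(1 - \<alpha>) *\<^sub>R quat_upper b + \<alpha> *\<^sub>R w \<in> quat_complex" if "w \<in> quat_complex" for w \<alpha>
    using that quat_upper_complex [of b] by (simp add: quat_complex_iff)
  then have "quat_upper b \<in> star_center (W \<inter> quat_complex)"
    using up quat_upper_complex by (auto simp: star_center_def)
  then show "b \<in> similarity_hull (star_center (W \<inter> quat_complex))"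
    using sim by (auto simp: similarity_hull_def similarity_class_def)
next
  fix b
  assume "b \<in> similarity_hull (star_center (W \<inter> quat_complex))"
  then obtain z where z: "z \<in> star_center (W \<inter> quat_complex)" and "quat_similar z b"
    by (auto simp: similarity_hull_def similarity_class_def)
  then show "b \<in> star_center W"
    using star_center_similar [OF inv star_center_complex_section [OF inv z]] quat_similar_sym
    by blast
qed

section \<open>The numerical range\<close>

text \<open>
  Scaling the vector \<open>x\<close> by a unit \<open>s\<close> on the right commutes with the matrix, which acts from the left,
  and turns \<open>x\<^sup>* A x\<close> into \<open>s\<^sup>* (x\<^sup>* A x) s\<close>.
\<close>

lemma numerical_range_similar:
  fixes A :: "quat ^ 'n ^ 'n"
  assumes "q \<in> numerical_range A" and "quat_similar p q"
  shows "p \<in> numerical_range A"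
proof -
  obtain x where q: "q = hprod x (A *v x)" and x: "norm x = 1"
    using assms(1) by (auto simp: numerical_range_def)
  obtain s where s: "norm s = 1" and p: "p = qcnj s * q * s"
    using assms(2) by (auto simp: quat_similar_def)
  define y :: "quat ^ 'n" where "y = (\<chi> i. x $ i * s)"
  have "norm y = norm x"
    by (simp add: norm_vec_def y_def norm_mult s)
  moreover have "(A *v y) $ i = (A *v x) $ i * s" for i
    by (simp add: matrix_vector_mult_def y_def sum_distrib_right mult.assoc)
  then have "hprod y (A *v y) = p"
    by (simp add: p q hprod_def y_def qcnj_mult sum_distrib_left sum_distrib_right mult.assoc)
  ultimately show ?thesis
    using x by (auto simp: numerical_range_def)
qed

theorem theorem3p8:
  fixes A :: "quat ^ 'n ^ 'n"
  shows "star_center (numerical_range A) =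
    similarity_hull (star_center (numerical_range A \<inter> quat_complex))"
  proof (rule star_center_similarity_invariant)
  show "similarity_hull (numerical_range A) \<subseteq> numerical_range A"
    by (auto simp: similarity_hull_def similarity_class_def
        intro: numerical_range_similar quat_similar_sym)
qed

end
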